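(* Let $\Sigma$ be a finite non-empty alphabet, $w\in\Sigma^*$ and $k,\ell\in\mathbb N$. If there exist a letter $a$ occurring in $w$, an integer exponent $k'\ge 0$ with $k'\ge k-\ell$, and words $x,y\in\Sigma^*$ with $|w|_a\ge k$ and $w=x\,a^{k'}y$, then the equivalence class of $w$ under $\overset{J}{\sim}_{k,\ell}$ is infinite.
   Context: $\mathbb N=\{1,2,\dots\}$, $\mathbb N_0=\mathbb N\cup\{0\}$. For a word $w\in\Sigma^*$, $|w|$ is its length, $|w|_a$ the number of occurrences of the letter $a$ in $w$, and $p(w)=(|w|_a)_{a\in\Sigma}$ its Parikh vector; $p(u)\le p(w)$ is meant componentwise. $\mathrm{ScatFact}(w)$ is the set of (not necessarily contiguous) subsequences of $w$. For $S\subseteq\Sigma^*$, $S_k=S\cap\Sigma^k$ and $S_{\le k}=\bigcup_{i=0}^k S_i$. For $\ell\in\mathbb N_0$, $\mathrm{JScatFact}(w,\ell)$ is the set of words $u\in\Sigma^*$ with $0\le\ell\le|u|-1$ (with only $\ell=0$ allowed if $u$ is empty), $p(u)\le p(w)$, and such that there is $v\in\mathrm{ScatFact}_{|u|-\ell}(u)$ with $v\in\mathrm{ScatFact}(w)$. For $v,w\in\Sigma^*$, $v\overset{J}{\sim}_{k,\ell}w$ means $\mathrm{JScatFact}_{\le k}(v,\ell)=\mathrm{JScatFact}_{\le k}(w,\ell)$; this is an equivalence relation on $\Sigma^*$. *)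

theory Defs
  imports "HOL-Library.Sublist"
begin

text \<open>
  The alphabet is a type of class \<open>finite\<close> (hence finite and non-empty), so the set of all
  words is the universe of the list type.
\<close>

definition parikh :: "'a list \<Rightarrow> 'a \<Rightarrow> nat" where
  "parikh w = (\<lambda>a. count_list w a)"

definition ScatFact :: "'a list \<Rightarrow> 'a list set" where
  "ScatFact w = {u. subseq u w}"

definition words_eq :: "'a list set \<Rightarrow> nat \<Rightarrow> 'a list set" where
  "words_eq S k = S \<inter> {u. length u = k}"

definition words_le :: "'a list set \<Rightarrow> nat \<Rightarrow> 'a list set" where
  "words_le S k = (\<Union>i\<le>k. words_eq S i)"

text \<open>
  The first conjunct is \<open>l \<le> length u - 1\<close> over the integers, with \<open>l = 0\<close> additionally
  allowed for the empty word; the natural subtraction below it therefore never truncates.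
  The order on Parikh vectors is the pointwise order on functions.
\<close>

definition JScatFact :: "'a list \<Rightarrow> nat \<Rightarrow> 'a list set" where
  "JScatFact w l =
     {u. (l < length u \<or> u = [] \<and> l = 0) \<and>
         parikh u \<le> parikh w \<and>
         (\<exists>v \<in> words_eq (ScatFact u) (length u - l). v \<in> ScatFact w)}"

definition J_sim :: "nat \<Rightarrow> nat \<Rightarrow> ('a list \<times> 'a list) set" where
  "J_sim k l = {(v, w). words_le (JScatFact v l) k = words_le (JScatFact w l) k}"

lemma equiv_J_sim: "equiv UNIV (J_sim k l)"
  by (auto simp: J_sim_def intro!: equivI refl_onI symI transI)

end

(* A word of length at most k - l embeds into x a^n y with at most k - l \<le> k' letters mapped
   into the block a^n, so enlarging the block beyond k' creates no new scattered factors of that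
   length. Since |w|_a \<ge> k, the Parikh condition on words of length at most k does not change
   either, so all x a^n y with n \<ge> k' are equivalent to w. *)

theory Submission imports Defs
begin

lemma subseq_replicate: "subseq v (replicate n a) \<Longrightarrow> v = replicate (length v) a"
  by (auto simp: subseq_conv_nths dest!: in_set_nthsD
      intro!: replicate_length_same[symmetric])

lemma subseq_replicate_mono: "m \<le> n \<Longrightarrow> subseq (replicate m a) (replicate n a)"
  using subseq_drop_many[of "replicate m a" "replicate m a" "replicate (n - m) a"]
  by (simp flip: replicate_add)

text \<open>An embedding splits \<open>v\<close> into pieces lying in \<open>x\<close>, in the block
  and in \<open>y\<close>. The middle piece is a power of \<open>a\<close> no longer than
  \<open>v\<close>, so a block of length \<open>m\<close> already holds it.\<close>

lemma subseq_shrink_block: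
  assumes "subseq v (x @ replicate n a @ y)" and "length v \<le> m"
  shows "subseq v (x @ replicate m a @ y)"
proof -
  obtain v1 v2 v3 where v: "v = v1 @ v2 @ v3"
    and sub: "subseq v1 x" "subseq v2 (replicate n a)" "subseq v3 y"
    using assms(1) by (auto simp: subseq_append_iff)
  have "subseq v2 (replicate m a)"
    using subseq_replicate[OF sub(2)] subseq_replicate_mono[of "length v2" m a] assms(2) v
    by simp
  then show ?thesis
    unfolding v using sub by (intro list_emb_append_mono)
qed

lemma subseq_grow_block:
  assumes "subseq v (x @ replicate m a @ y)" and "m \<le> n"
  shows "subseq v (x @ replicate n a @ y)"
proof -
  have "subseq (x @ replicate m a @ y) (x @ replicate n a @ y)"
    by (intro list_emb_append_mono subseq_replicate_mono assms(2)) simp_all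
  then show ?thesis
    using assms(1) subseq_order.order_trans by blast
qed

lemma JScatFact_pump_iff:
  assumes "length u \<le> k" and "k - l \<le> m" and "m \<le> n"
    and count: "k \<le> count_list (x @ replicate m a @ y) a"
  shows "u \<in> JScatFact (x @ replicate m a @ y) l \<longleftrightarrow> u \<in> JScatFact (x @ replicate n a @ y) l"
proof -
  have rep: "count_list (replicate i a) b = (if b = a then i else 0)" for i b
    by (induction i) auto
  have "count_list u a \<le> k"
    using count_le_length[of u a] assms(1) by linarith
  \<comment> \<open>For \<open>b = a\<close> both inequalities hold, as both counts on the right are
    at least \<open>k\<close>; any other letter occurs equally often in the two words.\<close>
  then have "count_list u b \<le> count_list (x @ replicate m a @ y) b
      \<longleftrightarrow> count_list u b \<le> count_list (x @ replicate n a @ y) b" for b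
    using count assms(3) by (cases "b = a") (auto simp: rep)
  then have "parikh u \<le> parikh (x @ replicate m a @ y)
      \<longleftrightarrow> parikh u \<le> parikh (x @ replicate n a @ y)"
    by (simp add: le_fun_def parikh_def)
  \<comment> \<open>Here \<open>length v\<close> is at most \<open>k - l\<close>, hence at most
    \<open>m\<close>, so the block can shrink from \<open>n\<close> to \<open>m\<close> as well as
    grow.\<close>
  moreover have "subseq v (x @ replicate m a @ y) \<longleftrightarrow> subseq v (x @ replicate n a @ y)"
    if "length v = length u - l" for v
    using that assms(1-3) subseq_grow_block subseq_shrink_block
    by (metis diff_le_mono le_trans)
  ultimately show ?thesis
    by (auto simp: JScatFact_def words_eq_def ScatFact_def)
qed

theorem proposition27:
  fixes w x y :: "'a::finite list" and a :: 'a and k l k' :: nat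
  assumes "k \<ge> 1" and "l \<ge> 1"
    and "a \<in> set w"
    and "int k' \<ge> int k - int l"
    and "count_list w a \<ge> k"
    and "w = x @ replicate k' a @ y"
  shows "infinite (J_sim k l `` {w})"
proof -
  let ?f = "\<lambda>n. x @ replicate n a @ y"
  \<comment> \<open>The integer bound on \<open>k'\<close> gives \<open>k - l \<le> k'\<close> also
    for truncated subtraction, which yields 0 when \<open>k < l\<close>.\<close>
  have "(w, ?f n) \<in> J_sim k l" if "n \<ge> k'" for n
    using JScatFact_pump_iff[of _ k l k' n x a y] that assms(4-6)
    by (auto simp: J_sim_def words_le_def words_eq_def)
  then have "?f ` {k'..} \<subseteq> J_sim k l `` {w}"
    by auto
  \<comment> \<open>Different exponents give words of different lengths.\<close>
  moreover have "inj_on ?f {k'..}"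
    by (auto simp: inj_on_def dest: arg_cong[where f = length])
  then have "infinite (?f ` {k'..})"
    by (simp add: finite_image_iff infinite_Ici)
  ultimately show ?thesis
    using finite_subset by blast
qed

end
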